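(* Let $n\ge 2$, let $\Omega\subset\mathbb{R}^2$ be open and simply connected, and let $A\in\mathcal{C}^1(\Omega,\mathbb{C}^{n\times n})$ have distinct singular values at every point of $\Omega$ and full rank everywhere in $\Omega$. Let $\Gamma$ be a circle centered at a point $\xi_0\in\Omega$, of radius $r>0$, entirely contained in $\Omega$, parametrized by $\gamma(t)=\xi_0+(r\cos(2\pi t),\,r\sin(2\pi t))$, $t\in[0,1]$. Let $A(\gamma(t))=U(t)\Sigma(t)V^*(t)$ be a joint-MVD of $A(\gamma(\cdot))$ over $[0,1]$, and let $\beta_j\in(-\pi,\pi]$, $j=1,\dots,n$, be defined through $$U^*(0)U(1)=V^*(0)V(1)=\operatorname{diag}(e^{i\beta_1},\dots,e^{i\beta_n}).$$ Then $$\sum_{j=1}^n\beta_j=0 \mod 2\pi .$$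
   Context: Smooth SVD and joint-MVD: for $B\in\mathcal{C}^k([0,1],\mathbb{C}^{n\times n})$, $k\ge1$, with distinct nonzero singular values $\sigma_1(t)>\dots>\sigma_n(t)>0$ for all $t$, a smooth SVD is a factorization $B(t)=U(t)\Sigma(t)V^*(t)$ with $U,V$ unitary, $\Sigma=\operatorname{diag}(\sigma_1,\dots,\sigma_n)$ and all factors of class $\mathcal{C}^k$ on $[0,1]$. A joint-MVD (joint minimum variation decomposition) of $B$ is a smooth SVD whose pair $(U,V)$ minimizes $$\int_0^1\sqrt{\|\dot U(t)\|_{\mathrm F}^2+\|\dot V(t)\|_{\mathrm F}^2}\,dt$$ among all smooth SVDs of $B$; it is uniquely determined by the choice of an SVD of $B(0)$, which may be arbitrary. Here $\|\cdot\|_{\mathrm F}$ is the Frobenius norm. *)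

theory Defs
  imports "HOL-Analysis.Analysis" "HOL-Library.Real_Mod"
begin

(* On an open subset of a Euclidean space. *)
definition C1_on :: "('a::euclidean_space \<Rightarrow> 'b::real_normed_vector) \<Rightarrow> 'a set \<Rightarrow> bool" where
  "C1_on f S \<longleftrightarrow>
     (\<exists>D :: 'a \<Rightarrow> 'a \<Rightarrow>\<^sub>L 'b.
        (\<forall>x\<in>S. (f has_derivative blinfun_apply (D x)) (at x)) \<and> continuous_on S D)"

(* On a compact interval; D j is the j-th derivative, one-sided at the endpoints.
   The library's C1_differentiable_on takes two-sided derivatives there instead, which
   would constrain the values of f outside the interval. *)
definition Ck_on_interval :: "nat \<Rightarrow> (real \<Rightarrow> 'b::real_normed_vector) \<Rightarrow> real \<Rightarrow> real \<Rightarrow> bool" where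
  "Ck_on_interval k f a b \<longleftrightarrow>
     (\<exists>D :: nat \<Rightarrow> real \<Rightarrow> 'b.
        (\<forall>t\<in>{a..b}. D 0 t = f t) \<and>
        (\<forall>j<k. \<forall>t\<in>{a..b}. (D j has_vector_derivative D (Suc j) t) (at t within {a..b})) \<and>
        continuous_on {a..b} (D k))"

type_synonym 'n csqmat = "complex^'n^'n"

definition conj_transpose :: "complex^'n^'m \<Rightarrow> complex^'m^'n" where
  "conj_transpose M = (\<chi> i j. cnj (M $ j $ i))"

definition unitary :: "('n::finite) csqmat \<Rightarrow> bool" where
  "unitary M \<longleftrightarrow> conj_transpose M ** M = mat 1 \<and> M ** conj_transpose M = mat 1"

definition diag :: "('n::finite \<Rightarrow> complex) \<Rightarrow> 'n csqmat" where
  "diag d = (\<chi> i j. if i = j then d i else 0)"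

definition singular_values :: "('n::finite) csqmat \<Rightarrow> real set" where
  "singular_values M =
     {\<sigma>. \<sigma> \<ge> 0 \<and> (\<exists>v. v \<noteq> 0 \<and> (conj_transpose M ** M) *v v = complex_of_real (\<sigma>\<^sup>2) *s v)}"

(* singular_values forgets multiplicities, so "all n singular values are distinct" is
   expressed by the set having n elements. *)
definition distinct_singular_values :: "('n::finite) csqmat \<Rightarrow> bool" where
  "distinct_singular_values M \<longleftrightarrow> card (singular_values M) = CARD('n)"

(* The index type is linearly ordered (in place of 1, ..., n) because the singular values
   are arranged in decreasing order along the diagonal. *)
definition smooth_SVD ::
  "nat \<Rightarrow> (real \<Rightarrow> 'n csqmat) \<Rightarrow> (real \<Rightarrow> 'n csqmat) \<Rightarrow> (real \<Rightarrow> 'n::{finite,linorder} \<Rightarrow> real)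
     \<Rightarrow> (real \<Rightarrow> 'n csqmat) \<Rightarrow> bool" where
  "smooth_SVD k B U \<sigma> V \<longleftrightarrow>
     Ck_on_interval k U 0 1 \<and>
     Ck_on_interval k (\<lambda>t. diag (\<lambda>j. complex_of_real (\<sigma> t j))) 0 1 \<and>
     Ck_on_interval k V 0 1 \<and>
     (\<forall>t\<in>{0..1}.
        unitary (U t) \<and> unitary (V t) \<and>
        (\<forall>i j. i < j \<longrightarrow> \<sigma> t i > \<sigma> t j) \<and> (\<forall>j. \<sigma> t j > 0) \<and>
        B t = U t ** diag (\<lambda>j. complex_of_real (\<sigma> t j)) ** conj_transpose (V t))"

(* The library norm on matrices is the Frobenius norm. *)
lemma norm_matrix_eq_Frobenius:
  fixes M :: "complex^'n^'m"
  shows "norm M = sqrt (\<Sum>i\<in>UNIV. \<Sum>j\<in>UNIV. (cmod (M $ i $ j))\<^sup>2)"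
  by (simp add: norm_vec_def L2_set_def sum_nonneg)

definition total_variation ::
  "(real \<Rightarrow> ('n::finite) csqmat) \<Rightarrow> (real \<Rightarrow> 'n csqmat) \<Rightarrow> real" where
  "total_variation U V =
     integral {0..1} (\<lambda>t. sqrt ((norm (vector_derivative U (at t within {0..1})))\<^sup>2
                              + (norm (vector_derivative V (at t within {0..1})))\<^sup>2))"

definition joint_MVD ::
  "nat \<Rightarrow> (real \<Rightarrow> 'n csqmat) \<Rightarrow> (real \<Rightarrow> 'n csqmat) \<Rightarrow> (real \<Rightarrow> 'n::{finite,linorder} \<Rightarrow> real)
     \<Rightarrow> (real \<Rightarrow> 'n csqmat) \<Rightarrow> bool" where
  "joint_MVD k B U \<sigma> V \<longleftrightarrow>
     smooth_SVD k B U \<sigma> V \<and>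
     (\<forall>U' \<sigma>' V'. smooth_SVD k B U' \<sigma>' V' \<longrightarrow> total_variation U V \<le> total_variation U' V')"

definition circle_path :: "real^2 \<Rightarrow> real \<Rightarrow> real \<Rightarrow> real^2" where
  "circle_path \<xi> r t = \<xi> + vector [r * cos (2 * pi * t), r * sin (2 * pi * t)]"

end

theory Submission
  imports Defs
begin

text \<open>
  Taking determinants in \<open>U(0)\<^sup>* U(1) = diag (exp (i \<beta>\<^sub>j))\<close> turns the claim into
  \<open>det U(1) = det U(0)\<close>. The curves \<open>det U\<close> and \<open>det V\<close> lie on the unit circle, and two facts,
  one metric and one topological, determine their product and their quotient.

  The product \<open>det U \<cdot> det V\<close> is constant, by minimality. Multiplying \<open>U\<close> and \<open>V\<close> by one common
  phase \<open>exp (i \<phi>(t))\<close> gives another smooth SVD, whose squared speed is a quadratic polynomial in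
  \<open>\<phi>'\<close>; choosing \<open>\<phi>'\<close> pointwise as its minimizer strictly shortens the curve unless the
  linear coefficient, which is the imaginary part of \<open>tr (U\<^sup>* U') + tr (V\<^sup>* V')\<close>, vanishes
  identically (\<open>joint_MVD_trace_eq_0\<close>). The real part vanishes because \<open>U\<close> and \<open>V\<close> have constant
  norm, and by Jacobi's formula the trace sum is the logarithmic derivative of the product
  (\<open>joint_MVD_det_product_constant\<close>).

  The quotient \<open>det U / det V\<close> is the phase of \<open>det A\<close> along the circle, since
  \<open>det \<Sigma> > 0\<close> (\<open>smooth_SVD_det_phase\<close>). As \<open>det A\<close> does not vanish on the simply connected
  \<open>\<Omega>\<close>, it has a continuous logarithm there, so this phase is \<open>exp (i \<theta>)\<close> with a
  continuous \<open>\<theta>\<close> that returns to its initial value.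

  Multiplying the two, \<open>(det U)\<^sup>2 = c exp (i \<theta>)\<close> for a constant \<open>c\<close>. Halving the angle,
  \<open>det U \<cdot> exp (- i \<theta> / 2)\<close> is a continuous square root of \<open>c\<close>, hence constant, and
  therefore \<open>det U\<close> closes up (\<open>square_lift_closed\<close>). Without the topological fact the product alone would
  give \<open>exp (2 i \<Sum> \<beta>\<^sub>j) = 1\<close>, that is, the claim modulo \<open>\<pi>\<close> only.
\<close>

section \<open>Determinants of unitary and full-rank matrices\<close>

lemma det_conj_transpose: "det (conj_transpose M) = cnj (det M)"
proof -
  have "conj_transpose M = transpose (\<chi> i j. cnj (M $ i $ j))"
    by (simp add: conj_transpose_def transpose_def)
  then have "det (conj_transpose M) = det (\<chi> i j. cnj (M $ i $ j))"
    by (simp add: det_transpose)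
  also have "\<dots> = cnj (det M)"
    by (simp add: det_def)
  finally show ?thesis .
qed

lemma det_diag: "det (diag d) = prod d UNIV"
  by (simp add: diag_def det_diagonal)

lemma unitary_cmod_det:
  assumes "unitary M"
  shows "cmod (det M) = 1"
proof -
  have "cnj (det M) * det M = 1"
    using assms by (metis unitary_def det_conj_transpose det_mul det_I)
  then have "(cmod (det M))\<^sup>2 = 1"
    by (metis complex_norm_square mult.commute of_real_eq_1_iff)
  then show ?thesis
    by (simp add: power2_eq_1_iff) (smt (verit) norm_ge_zero)
qed

lemma full_rank_imp_det_nonzero:
  fixes M :: "'a::field^'n^'n"
  assumes "rank M = CARD('n)"
  shows "det M \<noteq> 0"
proof -
  have "vec.span (rows M) = UNIV"
    using assms vec.dim_eq_full[of "rows M"]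
    by (simp add: row_rank_def_gen vec.dimension_def card_cart_basis)
  then obtain N where "N ** M = mat 1"
    using matrix_left_invertible_span_rows_gen by blast
  then show ?thesis
    using invertible_det_nz invertible_left_inverse by blast
qed

lemma continuous_on_det:
  fixes M :: "'a::topological_space \<Rightarrow> complex^'n^'n"
  assumes "continuous_on S M"
  shows "continuous_on S (\<lambda>t. det (M t))"
  unfolding det_def by (intro continuous_intros assms)

section \<open>Differentiating a determinant along a curve\<close>

lemma has_vector_derivative_entry:
  fixes M :: "real \<Rightarrow> complex^'n^'m"
  assumes "(M has_vector_derivative M') (at t within S)"
  shows "((\<lambda>t. M t $ i $ j) has_vector_derivative M' $ i $ j) (at t within S)"
  by (intro bounded_linear.has_vector_derivative[OF bounded_linear_vec_nth] assms)

text \<open>A permutation that fixes every point other than \<open>i\<close> fixes \<open>i\<close> as well; so in the derivative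
  of the Leibniz formula at the identity matrix only the identity permutation survives.\<close>

lemma prod_off_diagonal_mat_1:
  fixes p :: "'n::finite \<Rightarrow> 'n"
  assumes "p permutes UNIV"
  shows "(\<Prod>j\<in>UNIV - {i}. (mat 1 :: complex^'n^'n) $ j $ p j) = (if p = id then 1 else 0)"
proof (cases "p = id")
  case False
  have "\<exists>j. j \<noteq> i \<and> p j \<noteq> j"
  proof (rule ccontr)
    assume "\<not> ?thesis"
    then have fixed: "p j = j" if "j \<noteq> i" for j
      using that by blast
    have "p i = i"
      using fixed permutes_inj[OF assms] by (metis injD)
    with fixed have "p = id"
      by (metis eq_id_iff)
    with False show False ..
  qed
  then show ?thesis
    using False by (auto simp: mat_def intro!: prod_zero)
qed (simp add: mat_def)

lemma has_vector_derivative_det_at_identity: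
  fixes M :: "real \<Rightarrow> complex^'n^'n"
  assumes M: "(M has_vector_derivative M') (at t within S)" and "M t = mat 1"
  shows "((\<lambda>s. det (M s)) has_vector_derivative trace M') (at t within S)"
proof -
  have "((\<lambda>s. det (M s)) has_derivative
      (\<lambda>h. \<Sum>p | p permutes (UNIV::'n set). of_int (sign p) *
         (\<Sum>i\<in>UNIV. (h *\<^sub>R M' $ i $ p i) * (\<Prod>j\<in>UNIV - {i}. M t $ j $ p j)))) (at t within S)"
    unfolding det_def
    using has_vector_derivative_entry[OF M]
    by (intro has_derivative_sum has_derivative_mult_right has_derivative_prod)
       (simp_all add: has_vector_derivative_def)
  moreover have "(\<Sum>p | p permutes (UNIV::'n set). of_int (sign p) *
         (\<Sum>i\<in>UNIV. (h *\<^sub>R M' $ i $ p i) * (\<Prod>j\<in>UNIV - {i}. M t $ j $ p j))) = h *\<^sub>R trace M'" for h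
  proof -
    have "(\<Sum>p | p permutes (UNIV::'n set). of_int (sign p) *
         (\<Sum>i\<in>UNIV. (h *\<^sub>R M' $ i $ p i) * (\<Prod>j\<in>UNIV - {i}. M t $ j $ p j)))
        = (\<Sum>p | p permutes (UNIV::'n set). if p = id then h *\<^sub>R trace M' else 0)"
      by (rule sum.cong)
         (auto simp: assms(2) prod_off_diagonal_mat_1 trace_def scaleR_sum_right)
    also have "\<dots> = h *\<^sub>R trace M'"
      by (simp add: sum.delta permutes_id finite_permutations)
    finally show ?thesis .
  qed
  ultimately show ?thesis
    by (simp add: has_vector_derivative_def)
qed

text \<open>Jacobi's formula. It reduces to the derivative at the identity matrix by writing
  \<open>U s = U t (U t)\<^sup>* U s\<close> and pulling the constant factor out of the determinant.\<close>

lemma has_vector_derivative_det_at_unitary: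
  fixes U :: "real \<Rightarrow> 'n::finite csqmat"
  assumes "(U has_vector_derivative U') (at t within S)" and "unitary (U t)"
  shows "((\<lambda>s. det (U s)) has_vector_derivative
           det (U t) * trace (conj_transpose (U t) ** U')) (at t within S)"
proof -
  have "bounded_linear (\<lambda>X :: 'n csqmat. conj_transpose (U t) ** X)"
    by (intro linear_conv_bounded_linear[THEN iffD1] linearI)
       (simp_all add: vec_eq_iff matrix_matrix_mult_def distrib_left sum.distrib scaleR_sum_right)
  then have "((\<lambda>s. conj_transpose (U t) ** U s) has_vector_derivative
               conj_transpose (U t) ** U') (at t within S)"
    using assms(1) by (rule bounded_linear.has_vector_derivative)
  then have "((\<lambda>s. det (U t) * det (conj_transpose (U t) ** U s)) has_vector_derivative
               det (U t) * trace (conj_transpose (U t) ** U')) (at t within S)"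
    using assms(2)
    by (intro has_vector_derivative_mult_right has_vector_derivative_det_at_identity)
       (simp_all add: unitary_def)
  moreover have "det (U t) * det (conj_transpose (U t) ** X) = det X" for X
    using assms(2) by (metis det_I det_mul matrix_mul_assoc matrix_mul_lid unitary_def)
  ultimately show ?thesis
    by simp
qed

section \<open>Rotating both unitary factors by a common phase\<close>

definition cscale :: "complex \<Rightarrow> complex^'n^'m \<Rightarrow> complex^'n^'m" where
  "cscale c M = (\<chi> i j. c * M $ i $ j)"

lemma norm_cscale: "norm (cscale c M) = cmod c * norm M"
  by (simp add: norm_matrix_eq_Frobenius cscale_def norm_mult power_mult_distrib
      flip: sum_distrib_left) (simp add: real_sqrt_mult)

lemma bounded_bilinear_cscale: "bounded_bilinear (cscale :: complex \<Rightarrow> complex^'n^'m \<Rightarrow> _)"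
proof
  show "\<exists>K. \<forall>c (M :: complex^'n^'m). norm (cscale c M) \<le> norm c * norm M * K"
    by (rule exI[of _ 1]) (simp add: norm_cscale)
qed (simp_all add: cscale_def vec_eq_iff algebra_simps)

lemma cscale_cscale: "cscale c (cscale d M) = cscale (c * d) M"
  by (simp add: cscale_def vec_eq_iff mult.assoc)

lemma cscale_one: "cscale 1 M = M"
  by (simp add: cscale_def vec_eq_iff)

lemma conj_transpose_cscale: "conj_transpose (cscale c M) = cscale (cnj c) (conj_transpose M)"
  by (simp add: cscale_def conj_transpose_def vec_eq_iff)

lemma matrix_mul_cscale_left: "cscale c M ** N = cscale c (M ** N)"
  by (simp add: cscale_def matrix_matrix_mult_def vec_eq_iff sum_distrib_left mult.assoc)

lemma matrix_mul_cscale_right: "M ** cscale c N = cscale c (M ** N)"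
  by (simp add: cscale_def matrix_matrix_mult_def vec_eq_iff sum_distrib_left mult.left_commute)

lemma unit_phase_cnj: "cmod c = 1 \<Longrightarrow> cnj c * c = 1"
  by (metis complex_norm_square mult.commute of_real_1 power_one)

lemma unitary_cscale:
  assumes "unitary M" "cmod c = 1"
  shows "unitary (cscale c M)"
  using assms unit_phase_cnj[OF assms(2)]
  by (simp add: unitary_def conj_transpose_cscale matrix_mul_cscale_left matrix_mul_cscale_right
      cscale_cscale cscale_one mult.commute)

lemma cscale_conj_sandwich:
  assumes "cmod c = 1"
  shows "cscale c M ** D ** conj_transpose (cscale c N) = M ** D ** conj_transpose N"
  using unit_phase_cnj[OF assms]
  by (simp add: conj_transpose_cscale matrix_mul_cscale_left matrix_mul_cscale_right
      cscale_cscale cscale_one mult.commute)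

text \<open>The trace pairing \<open>tr (M\<^sup>* N)\<close> is the Hermitian inner product of matrices, whose real part is
  the Euclidean one. This links the variational condition, which is stated in terms of
  norms, to Jacobi's formula, which is stated in terms of traces.\<close>

lemma trace_conj_transpose_mult:
  fixes M N :: "'n::finite csqmat"
  shows "trace (conj_transpose M ** N) = Complex (N \<bullet> M) (N \<bullet> cscale \<i> M)"
proof -
  have "trace (conj_transpose M ** N) = (\<Sum>j\<in>UNIV. \<Sum>i\<in>UNIV. cnj (M $ i $ j) * N $ i $ j)"
    by (simp add: trace_def matrix_matrix_mult_def conj_transpose_def)
  also have "\<dots> = (\<Sum>i\<in>UNIV. \<Sum>j\<in>UNIV. cnj (M $ i $ j) * N $ i $ j)"
    by (rule sum.swap)
  finally show ?thesis
    by (simp add: complex_eq_iff inner_vec_def inner_complex_def cscale_def algebra_simps)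
qed

lemma unitary_norm_square:
  fixes M :: "'n::finite csqmat"
  assumes "unitary M"
  shows "M \<bullet> M = CARD('n)"
  using trace_conj_transpose_mult[of M M] assms
  by (simp add: unitary_def trace_I complex_eq_iff)

text \<open>A unitary curve moves on the sphere of radius \<open>sqrt n\<close>, so its velocity is tangential.\<close>

lemma unitary_derivative_orthogonal:
  fixes U :: "real \<Rightarrow> 'n::finite csqmat"
  assumes U: "(U has_vector_derivative U') (at t within {0..1})" and t: "t \<in> {0..1}"
    and unit: "\<And>s. s \<in> {0..1} \<Longrightarrow> unitary (U s)"
  shows "U' \<bullet> U t = 0"
proof -
  have "((\<lambda>s. U s \<bullet> U s) has_vector_derivative U t \<bullet> U' + U' \<bullet> U t) (at t within {0..1})"
    by (rule bounded_bilinear.has_vector_derivative[OF bounded_bilinear_inner U U])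
  moreover have "((\<lambda>s. U s \<bullet> U s) has_vector_derivative 0) (at t within {0..1})"
    by (rule has_vector_derivative_transform[OF t _ has_vector_derivative_const])
       (simp add: unit unitary_norm_square)
  ultimately have "U t \<bullet> U' + U' \<bullet> U t = 0"
    using t by (intro vector_derivative_unique_within[of t "{0..1}"])
               (auto simp: trivial_limit_within islimpt_Icc)
  then show ?thesis
    by (simp add: inner_commute)
qed

section \<open>Stationarity of a joint minimum variation decomposition\<close>

lemma Ck_on_interval_1_iff:
  "Ck_on_interval 1 f a b \<longleftrightarrow>
     (\<exists>f'. (\<forall>t\<in>{a..b}. (f has_vector_derivative f' t) (at t within {a..b})) \<and>
           continuous_on {a..b} f')" (is "?L \<longleftrightarrow> ?R")
proof
  assume ?L
  then obtain D where D: "\<forall>t\<in>{a..b}. D 0 t = f t"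
      "\<forall>t\<in>{a..b}. (D 0 has_vector_derivative D (Suc 0) t) (at t within {a..b})"
      "continuous_on {a..b} (D (Suc 0))"
    by (auto simp: Ck_on_interval_def)
  then have "\<forall>t\<in>{a..b}. (f has_vector_derivative D (Suc 0) t) (at t within {a..b})"
    by (metis has_vector_derivative_transform)
  with D(3) show ?R by blast
next
  assume ?R
  then obtain f' where "\<forall>t\<in>{a..b}. (f has_vector_derivative f' t) (at t within {a..b})"
      "continuous_on {a..b} f'" by blast
  then show ?L
    unfolding Ck_on_interval_def
    by (intro exI[of _ "\<lambda>j. if j = 0 then f else f'"]) auto
qed

text \<open>The phase factor \<open>cis (\<phi> t)\<close> is pulled out of the product rule because it does not affect norms:
  the speed of the rotated curve is the norm of the term in parentheses.\<close>

lemma has_vector_derivative_phase: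
  fixes M :: "real \<Rightarrow> complex^'n^'m"
  assumes M: "(M has_vector_derivative M') (at t within S)"
    and \<phi>: "(\<phi> has_vector_derivative \<omega>) (at t within S)"
  shows "((\<lambda>s. cscale (cis (\<phi> s)) (M s)) has_vector_derivative
           cscale (cis (\<phi> t)) (M' + \<omega> *\<^sub>R cscale \<i> (M t))) (at t within S)"
proof -
  have "((\<lambda>s. exp (\<i> * complex_of_real (\<phi> s))) has_vector_derivative
          (\<i> * complex_of_real \<omega>) * exp (\<i> * complex_of_real (\<phi> t))) (at t within S)"
    using field_vector_diff_chain_within[OF has_vector_derivative_mult_right[OF
          has_vector_derivative_of_real[OF \<phi>[folded has_real_derivative_iff_has_vector_derivative]], of \<i>] DERIV_exp[THEN DERIV_subset, OF subset_UNIV]]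
    by (simp add: o_def)
  then have "((\<lambda>s. cis (\<phi> s)) has_vector_derivative \<i> * complex_of_real \<omega> * cis (\<phi> t))
      (at t within S)"
    by (simp add: cis_conv_exp)
  from bounded_bilinear.has_vector_derivative[OF bounded_bilinear_cscale this M]
  show ?thesis
    by (rule has_vector_derivative_eq_rhs)
       (simp add: cscale_def vec_eq_iff scaleR_conv_of_real[where 'a = complex] algebra_simps)
qed

text \<open>These are the competitors in the minimization: the common phase cancels in \<open>U \<Sigma> V\<^sup>*\<close>.\<close>

lemma smooth_SVD_phase:
  assumes "smooth_SVD 1 B U \<sigma> V"
    and \<phi>: "\<And>t. t \<in> {0..1} \<Longrightarrow> (\<phi> has_vector_derivative \<omega> t) (at t within {0..1})"
    and \<omega>: "continuous_on {0..1} \<omega>"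
  shows "smooth_SVD 1 B (\<lambda>t. cscale (cis (\<phi> t)) (U t)) \<sigma> (\<lambda>t. cscale (cis (\<phi> t)) (V t))"
proof -
  have C1: "Ck_on_interval 1 (\<lambda>t. cscale (cis (\<phi> t)) (M t)) 0 1"
    if "Ck_on_interval 1 M 0 1" for M :: "real \<Rightarrow> 'a csqmat"
  proof -
    from that obtain M' where
      M: "\<And>t. t \<in> {0..1} \<Longrightarrow> (M has_vector_derivative M' t) (at t within {0..1})"
      and M': "continuous_on {0..1} M'"
      unfolding Ck_on_interval_1_iff by blast
    have "continuous_on {0..1} M" "continuous_on {0..1} \<phi>"
      by (rule continuous_on_vector_derivative, erule M, rule continuous_on_vector_derivative, erule \<phi>)
    then have "continuous_on {0..1}
        (\<lambda>t. cscale (cis (\<phi> t)) (M' t + \<omega> t *\<^sub>R cscale \<i> (M t)))"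
      by (intro bounded_bilinear.continuous_on[OF bounded_bilinear_cscale] continuous_intros M' \<omega>)
    then show ?thesis
      unfolding Ck_on_interval_1_iff
      by (intro exI conjI ballI) (rule has_vector_derivative_phase[OF M \<phi>])
  qed
  show ?thesis
    using assms(1) unfolding smooth_SVD_def
    by (auto simp del: One_nat_def simp: cscale_conj_sandwich intro!: C1 unitary_cscale)
qed

lemma total_variation_C1:
  assumes "\<And>t. t \<in> {0..1} \<Longrightarrow> (U has_vector_derivative U' t) (at t within {0..1})"
    and "\<And>t. t \<in> {0..1} \<Longrightarrow> (V has_vector_derivative V' t) (at t within {0..1})"
  shows "total_variation U V = integral {0..1} (\<lambda>t. sqrt ((norm (U' t))\<^sup>2 + (norm (V' t))\<^sup>2))"
  unfolding total_variation_def
proof (rule integral_cong)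
  fix t :: real assume t: "t \<in> {0..1}"
  show "sqrt ((norm (vector_derivative U (at t within {0..1})))\<^sup>2
        + (norm (vector_derivative V (at t within {0..1})))\<^sup>2)
      = sqrt ((norm (U' t))\<^sup>2 + (norm (V' t))\<^sup>2)"
    using vector_derivative_within_closed_interval[OF _ t assms(1)[OF t]]
      vector_derivative_within_closed_interval[OF _ t assms(2)[OF t]] by simp
qed

text \<open>The left-hand side is the quadratic polynomial
  \<open>\<parallel>X\<parallel>\<^sup>2 + \<parallel>Y\<parallel>\<^sup>2 + 2 a \<omega> + 2 n \<omega>\<^sup>2\<close> in \<open>\<omega>\<close>, evaluated at its minimizer.\<close>

lemma phase_speed_optimal:
  fixes X Y M N :: "'a::real_inner"
  assumes "M \<bullet> M = n" "N \<bullet> N = n" "n > 0"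
  defines "a \<equiv> X \<bullet> M + Y \<bullet> N"
  defines "\<omega> \<equiv> - a / (2 * n)"
  shows "(norm (X + \<omega> *\<^sub>R M))\<^sup>2 + (norm (Y + \<omega> *\<^sub>R N))\<^sup>2
           = (norm X)\<^sup>2 + (norm Y)\<^sup>2 - a\<^sup>2 / (2 * n)"
proof -
  have "(norm (X + \<omega> *\<^sub>R M))\<^sup>2 + (norm (Y + \<omega> *\<^sub>R N))\<^sup>2
      = (norm X)\<^sup>2 + (norm Y)\<^sup>2 + 2 * \<omega> * a + 2 * n * \<omega>\<^sup>2"
    using assms(1,2)
    unfolding power2_norm_eq_inner
    by (simp add: a_def inner_add_left inner_add_right inner_commute[of M X]
        inner_commute[of N Y] algebra_simps power2_eq_square)
  moreover have "2 * \<omega> * a + 2 * n * \<omega>\<^sup>2 = - (a\<^sup>2 / (2 * n))"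
    using assms(3) by (simp add: \<omega>_def field_simps power2_eq_square)
  ultimately show ?thesis by simp
qed

lemma continuous_le_integral_ge_imp_eq:
  fixes f g :: "real \<Rightarrow> real"
  assumes "continuous_on {0..1} f" "continuous_on {0..1} g"
    and le: "\<And>t. t \<in> {0..1} \<Longrightarrow> g t \<le> f t"
    and int: "integral {0..1} f \<le> integral {0..1} g"
    and t: "t \<in> {0..1}"
  shows "f t = g t"
proof -
  have fg: "f integrable_on {0..1}" "g integrable_on {0..1}"
    using assms by (auto intro: integrable_continuous_real)
  have "integral {0..1} g \<le> integral {0..1} f"
    using fg le by (intro integral_le) auto
  with int fg have "((\<lambda>t. f t - g t) has_integral 0) {0..1}"
    using has_integral_diff[OF integrable_integral integrable_integral, OF fg] by simp
  then have "f t - g t = 0"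
    using assms by (intro has_integral_0_cbox_imp_0[of 0 1 "\<lambda>t. f t - g t" t])
                   (auto intro!: continuous_intros)
  then show ?thesis by simp
qed

text \<open>The Euler--Lagrange equation of the variation functional for a common phase change of the two
  factors. It is obtained from a single competitor, the one with the pointwise optimal phase rate
  \<open>\<omega>\<close>, which is at most as fast at every time; so minimality forces equality of the speeds, and the squared speeds
  differ by \<open>a\<^sup>2 / (2 n)\<close>.\<close>

lemma joint_MVD_trace_eq_0:
  fixes U V :: "real \<Rightarrow> 'n::{finite,linorder} csqmat"
  assumes mvd: "joint_MVD 1 B U \<sigma> V"
    and U: "\<And>t. t \<in> {0..1} \<Longrightarrow> (U has_vector_derivative U' t) (at t within {0..1})"
    and V: "\<And>t. t \<in> {0..1} \<Longrightarrow> (V has_vector_derivative V' t) (at t within {0..1})"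
    and U': "continuous_on {0..1} U'" and V': "continuous_on {0..1} V'"
    and t: "t \<in> {0..1}"
  shows "trace (conj_transpose (U t) ** U' t) + trace (conj_transpose (V t) ** V' t) = 0"
proof -
  have svd: "smooth_SVD 1 B U \<sigma> V"
    using mvd by (simp add: joint_MVD_def)
  then have unit: "unitary (U s)" "unitary (V s)" if "s \<in> {0..1}" for s
    using that by (auto simp: smooth_SVD_def)
  define n where "n = real CARD('n)"
  have n: "n > 0" by (simp add: n_def)
  define a where "a s = U' s \<bullet> cscale \<i> (U s) + V' s \<bullet> cscale \<i> (V s)" for s
  (* The minimizer in phase_speed_optimal, applied to the rotation directions i U and i V. *)
  define \<omega> where "\<omega> s = - a s / (2 * n)" for s
  define \<phi> where "\<phi> s = integral {0..s} \<omega>" for s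
  have contUV: "continuous_on {0..1} U" "continuous_on {0..1} V"
    by (rule continuous_on_vector_derivative, erule U, rule continuous_on_vector_derivative, erule V)
  have conti: "continuous_on {0..1} (\<lambda>s. cscale \<i> (U s))" "continuous_on {0..1} (\<lambda>s. cscale \<i> (V s))"
    by (intro bounded_bilinear.continuous_on[OF bounded_bilinear_cscale] continuous_intros contUV)+
  have conta: "continuous_on {0..1} a"
    unfolding a_def by (intro continuous_intros conti U' V')
  have cont\<omega>: "continuous_on {0..1} \<omega>"
    unfolding \<omega>_def using n by (intro continuous_intros conta) auto
  have \<phi>: "(\<phi> has_vector_derivative \<omega> s) (at s within {0..1})" if "s \<in> {0..1}" for s
    unfolding \<phi>_def by (rule integral_has_vector_derivative[OF cont\<omega> that])
  let ?f = "\<lambda>s. sqrt ((norm (U' s))\<^sup>2 + (norm (V' s))\<^sup>2)"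
  let ?g = "\<lambda>s. sqrt ((norm (U' s))\<^sup>2 + (norm (V' s))\<^sup>2 - (a s)\<^sup>2 / (2 * n))"
  have speed: "(norm (cscale (cis (\<phi> s)) (U' s + \<omega> s *\<^sub>R cscale \<i> (U s))))\<^sup>2
      + (norm (cscale (cis (\<phi> s)) (V' s + \<omega> s *\<^sub>R cscale \<i> (V s))))\<^sup>2
      = (norm (U' s))\<^sup>2 + (norm (V' s))\<^sup>2 - (a s)\<^sup>2 / (2 * n)" if "s \<in> {0..1}" for s
  proof -
    (* Folding the inner products into squared norms lets norm_cscale remove the factor i. *)
    have "cscale \<i> (U s) \<bullet> cscale \<i> (U s) = n" "cscale \<i> (V s) \<bullet> cscale \<i> (V s) = n"
      using unit[OF that]
      by (simp_all add: n_def unitary_norm_square flip: power2_norm_eq_inner)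
         (simp_all add: norm_cscale power2_norm_eq_inner unitary_norm_square)
    from phase_speed_optimal[OF this n] show ?thesis
      by (simp add: norm_cscale a_def \<omega>_def)
  qed
  have "integral {0..1} ?f = total_variation U V"
    using total_variation_C1[OF U V] by simp
  also have "\<dots> \<le> total_variation (\<lambda>t. cscale (cis (\<phi> t)) (U t)) (\<lambda>t. cscale (cis (\<phi> t)) (V t))"
    using mvd smooth_SVD_phase[OF svd \<phi> cont\<omega>] unfolding joint_MVD_def by blast
  also have "\<dots> = integral {0..1} ?g"
    using speed
    by (subst total_variation_C1[OF has_vector_derivative_phase[OF U \<phi>]
          has_vector_derivative_phase[OF V \<phi>]]) (auto intro!: integral_cong)
  finally have "integral {0..1} ?f \<le> integral {0..1} ?g" .
  then have "?f t = ?g t"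
    using n by (intro continuous_le_integral_ge_imp_eq[OF _ _ _ _ t] continuous_intros U' V' conta)
               (auto simp: field_simps)
  then have "a t = 0"
    using n by (simp add: field_simps)
  then show ?thesis
    using unitary_derivative_orthogonal[OF U[OF t] t unit(1)]
      unitary_derivative_orthogonal[OF V[OF t] t unit(2)]
    by (simp add: trace_conj_transpose_mult complex_eq_iff a_def)
qed

text \<open>By Jacobi's formula the derivative of the product is the product itself times the sum of traces,
  which is zero.\<close>

lemma joint_MVD_det_product_constant:
  fixes U V :: "real \<Rightarrow> 'n::{finite,linorder} csqmat"
  assumes mvd: "joint_MVD 1 B U \<sigma> V"
  shows "\<exists>c. \<forall>t\<in>{0..1}. det (U t) * det (V t) = c"
proof -
  have svd: "smooth_SVD 1 B U \<sigma> V"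
    using mvd by (simp add: joint_MVD_def)
  then obtain U' V' where
    U: "\<And>t. t \<in> {0..1} \<Longrightarrow> (U has_vector_derivative U' t) (at t within {0..1})"
    and V: "\<And>t. t \<in> {0..1} \<Longrightarrow> (V has_vector_derivative V' t) (at t within {0..1})"
    and U': "continuous_on {0..1} U'" and V': "continuous_on {0..1} V'"
    unfolding smooth_SVD_def Ck_on_interval_1_iff by blast
  have "((\<lambda>s. det (U s) * det (V s)) has_vector_derivative 0) (at t within {0..1})"
    if t: "t \<in> {0..1}" for t
  proof -
    have "unitary (U t)" "unitary (V t)"
      using svd t by (auto simp: smooth_SVD_def)
    note has_vector_derivative_mult[OF has_vector_derivative_det_at_unitary[OF U[OF t] this(1)]
        has_vector_derivative_det_at_unitary[OF V[OF t] this(2)]]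
    moreover have "det (U t) * (det (V t) * trace (conj_transpose (V t) ** V' t))
        + det (U t) * trace (conj_transpose (U t) ** U' t) * det (V t) = 0"
      using joint_MVD_trace_eq_0[OF mvd U V U' V' t] by algebra
    ultimately show ?thesis by simp
  qed
  then show ?thesis
    by (intro has_derivative_zero_constant) (auto simp: has_vector_derivative_def)
qed

section \<open>The phase of the determinant around a loop\<close>

text \<open>Since \<open>det U\<close> and \<open>det V\<close> have modulus one and \<open>det \<Sigma>\<close> is positive,
  \<open>det B = det \<Sigma> \<cdot> (det U \<cdot> cnj (det V))\<close> is a polar decomposition; its uniqueness gives the
  phase.\<close>

lemma smooth_SVD_det_phase:
  assumes "smooth_SVD k B U \<sigma> V" "t \<in> {0..1}" "det (B t) = exp z"
  shows "det (U t) * cnj (det (V t)) = cis (Im z)"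
proof -
  define s where "s = (\<Prod>j\<in>UNIV. \<sigma> t j)"
  from assms have "unitary (U t)" "unitary (V t)" and pos: "\<And>j. \<sigma> t j > 0"
    and B: "B t = U t ** diag (\<lambda>j. complex_of_real (\<sigma> t j)) ** conj_transpose (V t)"
    by (auto simp: smooth_SVD_def)
  then have mod: "cmod (det (U t) * cnj (det (V t))) = 1"
    by (simp add: norm_mult unitary_cmod_det)
  have s: "s > 0"
    using pos by (auto simp: s_def intro: prod_pos)
  have eq: "exp z = of_real s * (det (U t) * cnj (det (V t)))"
    using assms(3) by (simp add: B det_mul det_diag det_conj_transpose s_def mult_ac)
  then have "exp (Re z) = s"
    using s mod by (metis abs_of_pos mult.right_neutral norm_exp_eq_Re norm_mult norm_of_real)
  then show ?thesis
    using eq s by (simp add: exp_eq_polar)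
qed

text \<open>The curve \<open>u\<close> is a lift of the closed curve \<open>c \<cdot> cis \<theta>\<close> through the double cover
  \<open>z \<mapsto> z\<^sup>2\<close>. Such lifts may change sign, but not when the base curve has a closed angle function:
  rotating \<open>u\<close> back by \<open>\<theta> / 2\<close> yields a continuous curve in the finite set of square roots
  of \<open>c\<close>.\<close>

lemma square_lift_closed:
  fixes u :: "real \<Rightarrow> complex" and \<theta> :: "real \<Rightarrow> real"
  assumes u: "continuous_on {0..1} u" and \<theta>: "continuous_on {0..1} \<theta>"
    and sq: "\<And>t. t \<in> {0..1} \<Longrightarrow> (u t)\<^sup>2 = c * cis (\<theta> t)"
    and closed: "\<theta> 0 = \<theta> 1"
  shows "u 0 = u 1"
proof -
  define q where "q t = u t * cis (- \<theta> t / 2)" for t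
  have "(q t)\<^sup>2 = c" if "t \<in> {0..1}" for t
  proof -
    have "(q t)\<^sup>2 = (u t)\<^sup>2 * cis (- \<theta> t)"
      by (simp add: q_def power_mult_distrib Complex.DeMoivre)
    then show ?thesis
      by (simp add: sq[OF that] cis_mult)
  qed
  then have "q ` {0..1} \<subseteq> {z. z\<^sup>2 = c}"
    by blast
  moreover have "finite {z. z\<^sup>2 = c}"
  proof -
    have "{z. z\<^sup>2 = c} \<subseteq> {csqrt c, - csqrt c}"
      using power2_eq_iff[of _ "csqrt c"] by auto
    then show ?thesis
      by (rule finite_subset) simp
  qed
  ultimately have "finite (q ` {0..1})"
    by (rule finite_subset)
  moreover have "continuous_on {0..1} q"
    unfolding q_def by (intro continuous_intros u \<theta>) auto
  ultimately have "q constant_on {0..1}"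
    by (intro continuous_finite_range_constant) auto
  then have "q 0 = q 1"
    by (auto simp: constant_on_def)
  then show ?thesis
    by (simp add: q_def closed)
qed

lemma continuous_on_circle_path: "continuous_on S (circle_path \<xi> r)"
proof -
  have "circle_path \<xi> r =
      (\<lambda>t. \<xi> + (\<chi> i. if i = 1 then r * cos (2 * pi * t) else r * sin (2 * pi * t)))"
    by (simp add: circle_path_def fun_eq_iff vec_eq_iff forall_2)
  moreover have "continuous_on S
      (\<lambda>t. if i = 1 then r * cos (2 * pi * t) else r * sin (2 * pi * t))" for i :: 2
    by (cases "i = 1") (auto intro!: continuous_intros)
  ultimately show ?thesis
    by (simp add: continuous_on_add continuous_on_vec_lambda)
qed

theorem theorem3p12:
  fixes \<Omega> :: "(real^2) set"
    and A :: "real^2 \<Rightarrow> ('n::{finite,linorder}) csqmat"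
    and \<xi>\<^sub>0 :: "real^2" and r :: real
    and U V :: "real \<Rightarrow> 'n csqmat"
    and \<sigma> :: "real \<Rightarrow> 'n \<Rightarrow> real"
    and \<beta> :: "'n \<Rightarrow> real"
  assumes "CARD('n) \<ge> 2"
    and "open \<Omega>" and "simply_connected \<Omega>"
    and "C1_on A \<Omega>"
    and "\<And>x. x \<in> \<Omega> \<Longrightarrow> distinct_singular_values (A x)"
    and "\<And>x. x \<in> \<Omega> \<Longrightarrow> rank (A x) = CARD('n)"
    and "\<xi>\<^sub>0 \<in> \<Omega>" and "r > 0"
    and "circle_path \<xi>\<^sub>0 r ` {0..1} \<subseteq> \<Omega>"
    and "joint_MVD 1 (\<lambda>t. A (circle_path \<xi>\<^sub>0 r t)) U \<sigma> V"
    and "\<And>j. \<beta> j \<in> {-pi<..pi}"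
    and "conj_transpose (U 0) ** U 1 = diag (\<lambda>j. exp (\<i> * complex_of_real (\<beta> j)))"
    and "conj_transpose (V 0) ** V 1 = diag (\<lambda>j. exp (\<i> * complex_of_real (\<beta> j)))"
  shows "[(\<Sum>j\<in>UNIV. \<beta> j) = 0] (rmod (2 * pi))"
proof -
  let ?\<gamma> = "circle_path \<xi>\<^sub>0 r"
  have "continuous_on \<Omega> A"
    using assms(4) unfolding C1_on_def
    by (metis continuous_at_imp_continuous_on has_derivative_continuous)
  then have cont: "continuous_on \<Omega> (\<lambda>x. det (A x))"
    by (rule continuous_on_det)
  have nz: "det (A x) \<noteq> 0" if "x \<in> \<Omega>" for x
    by (rule full_rank_imp_det_nonzero[OF assms(6)[OF that]])
  obtain g where g: "continuous_on \<Omega> g" "\<And>x. x \<in> \<Omega> \<Longrightarrow> det (A x) = exp (g x)"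
    using continuous_logarithm_on_simply_connected[OF cont assms(3)
        open_imp_locally_path_connected[OF assms(2)] nz] by metis
  define \<theta> where "\<theta> t = Im (g (?\<gamma> t))" for t
  have \<gamma>: "continuous_on {0..1} ?\<gamma>"
    by (rule continuous_on_circle_path)
  have \<theta>: "continuous_on {0..1} \<theta>"
    unfolding \<theta>_def
    by (intro continuous_intros continuous_on_compose2[OF g(1) \<gamma>] assms(9))
  have \<theta>01: "\<theta> 0 = \<theta> 1"
    by (simp add: \<theta>_def circle_path_def)
  have svd: "smooth_SVD 1 (\<lambda>t. A (?\<gamma> t)) U \<sigma> V"
    using assms(10) by (simp add: joint_MVD_def)
  obtain c where c: "\<And>t. t \<in> {0..1} \<Longrightarrow> det (U t) * det (V t) = c"
    using joint_MVD_det_product_constant[OF assms(10)] by blast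
  (* The square of det U is its product with det V times its quotient by det V. *)
  have sq: "(det (U t))\<^sup>2 = c * cis (\<theta> t)" if t: "t \<in> {0..1}" for t
  proof -
    have "unitary (V t)"
      using svd t by (auto simp: smooth_SVD_def)
    then have "cnj (det (V t)) * det (V t) = 1"
      by (simp add: unit_phase_cnj unitary_cmod_det)
    moreover have "det (U t) * cnj (det (V t)) = cis (\<theta> t)"
      unfolding \<theta>_def using smooth_SVD_det_phase[OF svd t] g(2) assms(9) t by blast
    ultimately show ?thesis
      using c[OF t] by algebra
  qed
  have "continuous_on {0..1} U"
    using svd unfolding smooth_SVD_def Ck_on_interval_1_iff
    by (blast intro: continuous_on_vector_derivative)
  then have eq: "det (U 0) = det (U 1)"
    by (rule square_lift_closed[OF continuous_on_det \<theta> sq \<theta>01])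
  have "unitary (U 0)"
    using svd by (auto simp: smooth_SVD_def)
  then have "cnj (det (U 0)) * det (U 1) = 1"
    by (simp add: unit_phase_cnj unitary_cmod_det flip: eq)
  then have "exp (\<i> * complex_of_real (\<Sum>j\<in>UNIV. \<beta> j)) = 1"
    using arg_cong[OF assms(12), of det]
    by (simp add: det_mul det_conj_transpose det_diag exp_sum sum_distrib_left)
  then obtain m :: int where "(\<Sum>j\<in>UNIV. \<beta> j) = of_int (2 * m) * pi"
    by (auto simp: exp_eq_1)
  then show ?thesis
    unfolding rcong_altdef by (intro exI[of _ "- m"]) simp
qed

end
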